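(* Let $A = (a_1,\ldots,a_{d-1},a_d)$ be a sequence of integers with $1 \le a_1,\ldots,a_{d-1} \le a_d$, let $a_0$ be an integer with $1 \le a_0 \le a_d$ such that $a_d \mid (a_0 + a_1 + \cdots + a_{d-1} + 1)$, and let $r$ be a positive integer. Suppose that $1 \le a_0, a_1,\ldots,a_{d-1} < a_d$. Then $\Delta(A)$ is Gorenstein of index $r$ if and only if the following conditions are satisfied: - for $0 \le i \le d-1$, $a_i \mid a_d$; - $r a_d = a_0 + a_1 + \cdots + a_{d-1} + 1$.
   Context: $e_1,\ldots,e_d$ are the canonical unit coordinate vectors of $\mathbb{R}^d$. For a sequence of integers $A=(a_1,\ldots,a_d)$ with $1 \le a_1,\ldots,a_{d-1} \le a_d$, set $\Delta(A) = \mathrm{conv}(v_0,\ldots,v_d) \subset \mathbb{R}^d$, where $v_0 = (0,\ldots,0)$, $v_i = e_i$ for $1 \le i \le d-1$, and $v_d = \sum_{j=1}^{d-1}(a_d - a_j)e_j + a_d e_d$; it is a $d$-dimensional lattice simplex. A lattice polytope is a convex polytope all of whose vertices have integer coordinates. A $d$-dimensional lattice polytope $\mathcal{Q} \subset \mathbb{R}^d$ is reflexive if the origin is the unique lattice point in its interior and its dual polytope $\mathcal{Q}^\vee = \{y \in \mathbb{R}^d : \langle x,y\rangle \le 1 \text{ for all } x \in \mathcal{Q}\}$ is also a lattice polytope. A $d$-dimensional lattice polytope $\mathcal{P} \subset \mathbb{R}^d$ is Gorenstein of index $r$ ($r \in \mathbb{Z}_{>0}$) if there exist a reflexive polytope $\mathcal{Q}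 \subset \mathbb{R}^d$ and $w \in \mathbb{Z}^d$ with $\mathcal{Q} = r\mathcal{P} + w$. *)

theory Defs
  imports "HOL-Analysis.Analysis"
begin

definition integer_lattice :: "(real ^ 'n) set"
  where "integer_lattice = {x. \<forall>i. x $ i \<in> \<int>}"

definition lattice_polytope :: "(real ^ 'n) set \<Rightarrow> bool"
  where "lattice_polytope P \<longleftrightarrow>
    polytope P \<and> (\<forall>v. v extreme_point_of P \<longrightarrow> v \<in> integer_lattice)"

definition full_dim_lattice_polytope :: "(real ^ 'n) set \<Rightarrow> bool"
  where "full_dim_lattice_polytope P \<longleftrightarrow>
    lattice_polytope P \<and> aff_dim P = int CARD('n)"

definition dual_polytope :: "(real ^ 'n) set \<Rightarrow> (real ^ 'n) set"
  where "dual_polytope Q = {y. \<forall>x\<in>Q. x \<bullet> y \<le> 1}"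

definition reflexive :: "(real ^ 'n) set \<Rightarrow> bool"
  where "reflexive Q \<longleftrightarrow>
    full_dim_lattice_polytope Q \<and>
    interior Q \<inter> integer_lattice = {0} \<and>
    lattice_polytope (dual_polytope Q)"

definition gorenstein_of_index :: "nat \<Rightarrow> (real ^ 'n) set \<Rightarrow> bool"
  where "gorenstein_of_index r P \<longleftrightarrow>
    full_dim_lattice_polytope P \<and> r > 0 \<and>
    (\<exists>Q w. reflexive Q \<and> w \<in> integer_lattice \<and> Q = (\<lambda>x. real r *\<^sub>R x + w) ` P)"

text \<open>
  The index type of \<open>real ^ 'n\<close> carries no order, so the canonical unit vectors
  \<open>e 1, \<dots>, e d\<close> (with \<open>d = CARD('n)\<close>) are given by an arbitrary enumeration of
  the standard basis.
\<close>

definition unit_vector_enum :: "(nat \<Rightarrow> real ^ 'n) \<Rightarrow> bool"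
  where "unit_vector_enum e \<longleftrightarrow> bij_betw e {1..CARD('n)} Basis"

text \<open>
  A sequence \<open>a\<^sub>1, \<dots>, a\<^sub>d\<close> is a function on \<open>nat\<close> of which only the values at
  \<open>1, \<dots>, d\<close> matter here; in particular the value at \<open>0\<close> does not enter the simplex.
\<close>

definition Delta_vertex :: "(nat \<Rightarrow> real ^ 'n) \<Rightarrow> (nat \<Rightarrow> int) \<Rightarrow> nat \<Rightarrow> real ^ 'n"
  where "Delta_vertex e a i =
    (if i = 0 then 0
     else if i < CARD('n) then e i
     else (\<Sum>j=1..<CARD('n). real_of_int (a CARD('n) - a j) *\<^sub>R e j)
          + real_of_int (a CARD('n)) *\<^sub>R e CARD('n))"

definition Delta :: "(nat \<Rightarrow> real ^ 'n) \<Rightarrow> (nat \<Rightarrow> int) \<Rightarrow> (real ^ 'n) set"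
  where "Delta e a = convex hull (Delta_vertex e a ` {0..CARD('n)})"

end

theory Submission
  imports Defs
begin

text \<open>
  Write \<open>N = a d\<close>. Barycentric coordinates turn reflexivity of a dilated simplex into a condition on
  one lattice point. Let \<open>c i + g i \<bullet> x\<close> be the coordinates of \<open>x\<close> with respect to the vertices
  \<open>v i\<close>. The polytope \<open>r P + w\<close> is cut out by the inequalities \<open>\<mu> i + g i \<bullet> x \<ge> 0\<close>, where
  \<open>\<mu> i = r * c i + g i \<bullet> p\<close> and \<open>p = - w\<close>. If all \<open>\<mu> i\<close> are positive, then the dual polytope is
  the simplex with vertices \<open>- g i / \<mu> i\<close>. Hence \<open>r P + w\<close>, having integral vertices, is reflexive
  iff every \<open>\<mu> i\<close> is positive and every \<open>g i / \<mu> i\<close> is integral (\<open>reflexive_dilate_iff\<close>); that \<open>0\<close>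
  is the only interior lattice point is then automatic.

  For \<open>\<Delta>(A)\<close> the gradients are \<open>g d = e d / N\<close> and, for \<open>i < d\<close>, a lattice vector plus
  \<open>(a i / N) e d\<close> (\<open>gradient_mod_lattice\<close>); for \<open>i = 0\<close> this is what the divisibility hypothesis on
  \<open>a 0\<close> gives.

  Suppose that \<open>p\<close> is a lattice point with \<open>\<mu> i > 0\<close> and \<open>g i / \<mu> i\<close> integral. Pairing
  \<open>g i / \<mu> i\<close> with an edge at the vertex \<open>v i\<close> shows that \<open>1 / \<mu> i\<close> is an integer, so
  \<open>\<mu> i \<le> 1\<close>. Since \<open>g d / \<mu> d = e d / (p \<bullet> e d)\<close> is integral, \<open>p \<bullet> e d = 1\<close>. Therefore
  \<open>\<mu> i\<close> and \<open>a i / N\<close> differ by an integer for \<open>i < d\<close>, and as \<open>0 < a i < N\<close> they are equal.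
  Now \<open>N / a i = 1 / \<mu> i\<close> is an integer, and \<open>r = (\<Sum>i\<le>d. \<mu> i)\<close> becomes the second condition.

  Conversely, take \<open>p = e 1 + \<dots> + e d\<close>. Then \<open>\<mu> d = 1 / N\<close> and \<open>\<mu> i = a i / N\<close> for \<open>i < d\<close>,
  where the case \<open>i = 0\<close> is the second condition. The vector \<open>g i / \<mu> i\<close> is \<open>N / a i\<close> times a
  lattice vector plus \<open>e d\<close>, hence integral by the first condition.
\<close>

section \<open>Lattice points\<close>

lemma integer_lattice_iff_Basis: "x \<in> integer_lattice \<longleftrightarrow> (\<forall>b\<in>Basis. x \<bullet> b \<in> \<int>)"
  by (auto simp: integer_lattice_def Basis_vec_def inner_axis)

lemma integer_lattice_0: "0 \<in> integer_lattice"
  by (simp add: integer_lattice_def)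

lemma integer_lattice_add:
  "x \<in> integer_lattice \<Longrightarrow> y \<in> integer_lattice \<Longrightarrow> x + y \<in> integer_lattice"
  by (simp add: integer_lattice_def)

lemma integer_lattice_minus: "x \<in> integer_lattice \<Longrightarrow> - x \<in> integer_lattice"
  by (simp add: integer_lattice_def)

lemma integer_lattice_diff:
  "x \<in> integer_lattice \<Longrightarrow> y \<in> integer_lattice \<Longrightarrow> x - y \<in> integer_lattice"
  by (simp add: integer_lattice_def)

lemma integer_lattice_scaleR:
  "k \<in> \<int> \<Longrightarrow> x \<in> integer_lattice \<Longrightarrow> k *\<^sub>R x \<in> integer_lattice"
  by (simp add: integer_lattice_def)

lemma integer_lattice_sum:
  "(\<And>i. i \<in> I \<Longrightarrow> f i \<in> integer_lattice) \<Longrightarrow> sum f I \<in> integer_lattice"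
  by (simp add: integer_lattice_def Ints_sum)

lemma inner_integer_lattice:
  "x \<in> integer_lattice \<Longrightarrow> y \<in> integer_lattice \<Longrightarrow> x \<bullet> y \<in> \<int>"
  unfolding inner_vec_def by (intro Ints_sum) (auto simp: integer_lattice_def)

lemma lattice_polytope_convex_hull:
  assumes "finite S" "S \<subseteq> integer_lattice"
  shows "lattice_polytope (convex hull S)"
  using assms extreme_point_of_convex_hull
  unfolding lattice_polytope_def polytope_def by blast

section \<open>Dilated simplices in barycentric coordinates and their duals\<close>

text \<open>
  A full-dimensional simplex given together with its barycentric coordinates \<open>c i + g i \<bullet> x\<close>. The
  gradients \<open>g i\<close> are inner normals of the facets, normalized to increase by 1 from the facet to the
  opposite vertex.
\<close>

locale barycentric_simplex =
  fixes I :: "'i set" and v g :: "'i \<Rightarrow> real ^ 'n" and c :: "'i \<Rightarrow> real"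
  assumes finite_I: "finite I"
    and coord_vertex: "i \<in> I \<Longrightarrow> k \<in> I \<Longrightarrow> c i + g i \<bullet> v k = (if i = k then 1 else 0)"
    and coord_sum: "(\<Sum>i\<in>I. c i + g i \<bullet> x) = 1"
    and coord_expand: "(\<Sum>i\<in>I. (c i + g i \<bullet> x) *\<^sub>R v i) = x"
begin

definition body :: "(real ^ 'n) set"
  where "body = convex hull (v ` I)"

text \<open>
  The value at the origin of the \<open>i\<close>-th facet inequality of the dilated and translated simplex; it
  is positive for all \<open>i\<close> iff the origin lies in the interior.
\<close>

definition depth :: "real \<Rightarrow> real ^ 'n \<Rightarrow> 'i \<Rightarrow> real"
  where "depth r w i = r * c i - g i \<bullet> w"

text \<open>
  Dividing \<open>depth r w i + g i \<bullet> x \<ge> 0\<close> by the depth puts the facet inequality in the form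
  \<open>u \<bullet> x \<le> 1\<close>, whose normal \<open>u\<close> is a vertex of the dual polytope.
\<close>

definition dual_vertex :: "real \<Rightarrow> real ^ 'n \<Rightarrow> 'i \<Rightarrow> real ^ 'n"
  where "dual_vertex r w i = - (g i /\<^sub>R depth r w i)"

lemma sum_c: "(\<Sum>i\<in>I. c i) = 1"
  using coord_sum[of 0] by simp

lemma sum_gradient_inner: "(\<Sum>i\<in>I. g i \<bullet> x) = 0"
  using coord_sum[of x] sum_c by (simp add: sum.distrib)

lemma sum_gradient: "(\<Sum>i\<in>I. g i) = 0"
  using sum_gradient_inner[of "\<Sum>i\<in>I. g i"] by (simp only: inner_eq_zero_iff flip: inner_sum_left)

lemma expand_linear: "(\<Sum>i\<in>I. (g i \<bullet> x) *\<^sub>R v i) = x"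
  using coord_expand[of x] coord_expand[of 0]
  by (simp add: scaleR_add_left sum.distrib)

text \<open>
  The linear map in \<open>expand_linear\<close> is the identity; this is the corresponding formula for its
  adjoint, with vertices and gradients exchanging roles.
\<close>

lemma expand_adjoint: "(\<Sum>i\<in>I. (v i \<bullet> y) *\<^sub>R g i) = y"
proof (rule inner_eq_zero_iff[THEN iffD1, THEN eq_iff_diff_eq_0[THEN iffD2]])
  have adj: "(\<Sum>i\<in>I. (v i \<bullet> y) *\<^sub>R g i) \<bullet> x = y \<bullet> x" for x
  proof -
    have "y \<bullet> x = y \<bullet> (\<Sum>i\<in>I. (g i \<bullet> x) *\<^sub>R v i)"
      by (simp add: expand_linear)
    then show ?thesis
      by (simp add: inner_sum_left inner_sum_right inner_commute mult.commute)
  qed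
  show "((\<Sum>i\<in>I. (v i \<bullet> y) *\<^sub>R g i) - y) \<bullet> ((\<Sum>i\<in>I. (v i \<bullet> y) *\<^sub>R g i) - y) = 0"
    by (simp add: inner_diff_left adj)
qed

text \<open>With a single vertex the coordinates would make the whole space a point.\<close>

lemma another_vertex:
  assumes "i \<in> I"
  obtains k where "k \<in> I" "k \<noteq> i"
proof (rule ccontr)
  assume "\<not> thesis"
  with that assms have I: "I = {i}" by blast
  have "x = v i" for x
    using coord_expand[of x] coord_sum[of x] by (simp add: I)
  then have "(0 :: real ^ 'n) = 1" by metis
  then show False by simp
qed

lemma gradient_edge:
  assumes "i \<in> I" "k \<in> I" "k \<noteq> i"
  shows "g i \<bullet> (v i - v k) = 1"
  using coord_vertex[of i i] coord_vertex[of i k] assms by (simp add: inner_diff_right)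

lemma gradient_nonzero: "i \<in> I \<Longrightarrow> g i \<noteq> 0"
  by (metis another_vertex gradient_edge inner_zero_left zero_neq_one)

lemma body_eq_halfspaces: "body = {x. \<forall>i\<in>I. c i + g i \<bullet> x \<ge> 0}"
proof (intro subset_antisym)
  have halfspace: "0 \<le> c i + g i \<bullet> x \<longleftrightarrow> - c i \<le> g i \<bullet> x" for i x by linarith
  show "body \<subseteq> {x. \<forall>i\<in>I. c i + g i \<bullet> x \<ge> 0}"
    unfolding body_def
  proof (rule hull_minimal)
    show "v ` I \<subseteq> {x. \<forall>i\<in>I. c i + g i \<bullet> x \<ge> 0}"
      using coord_vertex by auto
    have "{x. \<forall>i\<in>I. c i + g i \<bullet> x \<ge> 0} = (\<Inter>i\<in>I. {x. g i \<bullet> x \<ge> - c i})"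
      by (auto simp: halfspace)
    then show "convex {x. \<forall>i\<in>I. c i + g i \<bullet> x \<ge> 0}"
      by (simp add: convex_INT convex_halfspace_ge)
  qed
  show "{x. \<forall>i\<in>I. c i + g i \<bullet> x \<ge> 0} \<subseteq> body"
  proof
    fix x assume "x \<in> {x. \<forall>i\<in>I. c i + g i \<bullet> x \<ge> 0}"
    then have "(\<Sum>i\<in>I. (c i + g i \<bullet> x) *\<^sub>R v i) \<in> body"
      unfolding body_def
      by (intro convex_sum finite_I convex_convex_hull coord_sum) (auto intro: hull_inc)
    then show "x \<in> body" by (simp add: coord_expand)
  qed
qed

lemma dilate_eq_halfspaces:
  assumes "r > 0"
  shows "(\<lambda>x. r *\<^sub>R x + w) ` body = {x. \<forall>i\<in>I. depth r w i + g i \<bullet> x \<ge> 0}"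
proof -
  have key: "depth r w i + g i \<bullet> (r *\<^sub>R x + w) = r * (c i + g i \<bullet> x)" for i x
    by (simp add: depth_def inner_add_right algebra_simps)
  have "x = r *\<^sub>R ((x - w) /\<^sub>R r) + w" for x
    using assms by simp
  then have "(\<exists>y. (\<forall>i\<in>I. c i + g i \<bullet> y \<ge> 0) \<and> x = r *\<^sub>R y + w) \<longleftrightarrow>
      (\<forall>i\<in>I. depth r w i + g i \<bullet> x \<ge> 0)" for x
    using key assms by (metis zero_le_mult_iff less_le_not_le)
  then show ?thesis
    unfolding body_eq_halfspaces image_def by auto
qed

lemma interior_dilate:
  assumes "r > 0"
  shows "interior ((\<lambda>x. r *\<^sub>R x + w) ` body) = {x. \<forall>i\<in>I. depth r w i + g i \<bullet> x > 0}"
proof (intro subset_antisym)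
  let ?H = "\<lambda>i. {x. g i \<bullet> x \<ge> - depth r w i}"
  have halfspace: "0 \<le> depth r w i + g i \<bullet> x \<longleftrightarrow> - depth r w i \<le> g i \<bullet> x"
    and open_halfspace: "0 < depth r w i + g i \<bullet> x \<longleftrightarrow> - depth r w i < g i \<bullet> x" for i x
    by linarith+
  have *: "(\<lambda>x. r *\<^sub>R x + w) ` body = (\<Inter>i\<in>I. ?H i)"
    unfolding dilate_eq_halfspaces[OF assms] by (auto simp: halfspace)
  have "interior ((\<lambda>x. r *\<^sub>R x + w) ` body) \<subseteq> interior (?H i)" if "i \<in> I" for i
    using that unfolding * by (intro interior_mono) auto
  then show "interior ((\<lambda>x. r *\<^sub>R x + w) ` body) \<subseteq> {x. \<forall>i\<in>I. depth r w i + g i \<bullet> x > 0}"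
    using gradient_nonzero by (fastforce simp: interior_halfspace_ge)
  have "{x. \<forall>i\<in>I. depth r w i + g i \<bullet> x > 0} = (\<Inter>i\<in>I. {x. g i \<bullet> x > - depth r w i})"
    by (auto simp: open_halfspace)
  then have "open {x. \<forall>i\<in>I. depth r w i + g i \<bullet> x > 0}"
    by (simp add: open_INT finite_I open_halfspace_gt)
  then show "{x. \<forall>i\<in>I. depth r w i + g i \<bullet> x > 0} \<subseteq> interior ((\<lambda>x. r *\<^sub>R x + w) ` body)"
    unfolding dilate_eq_halfspaces[OF assms] by (intro interior_maximal) (auto intro: less_imp_le)
qed

lemma sum_depth: "(\<Sum>i\<in>I. depth r w i) = r"
  by (simp add: depth_def sum_subtractf sum_gradient_inner sum_c flip: sum_distrib_left)

lemma sum_depth_vertex: "(\<Sum>i\<in>I. depth r w i *\<^sub>R (r *\<^sub>R v i + w)) = 0"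
proof -
  have "(\<Sum>i\<in>I. depth r w i *\<^sub>R v i) = r *\<^sub>R (\<Sum>i\<in>I. c i *\<^sub>R v i) - (\<Sum>i\<in>I. (g i \<bullet> w) *\<^sub>R v i)"
    by (simp add: depth_def scaleR_diff_left sum_subtractf scaleR_sum_right)
  also have "\<dots> = - w"
    using coord_expand[of 0] by (simp add: expand_linear)
  finally have 1: "(\<Sum>i\<in>I. depth r w i *\<^sub>R v i) = - w" .
  have "(\<Sum>i\<in>I. depth r w i *\<^sub>R (r *\<^sub>R v i + w))
      = r *\<^sub>R (\<Sum>i\<in>I. depth r w i *\<^sub>R v i) + (\<Sum>i\<in>I. depth r w i) *\<^sub>R w"
    by (simp add: scaleR_add_right sum.distrib scaleR_sum_right scaleR_sum_left mult.commute)
  then show ?thesis by (simp add: 1 sum_depth)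
qed

text \<open>
  The dual vertex \<open>i\<close> has value 1 on the whole facet opposite to vertex \<open>i\<close>; this incidence between
  vertices and facets is what makes the dual polytope a simplex as well.
\<close>

lemma vertex_dual_vertex:
  assumes "i \<in> I" "k \<in> I" "depth r w i > 0"
  shows "(r *\<^sub>R v k + w) \<bullet> dual_vertex r w i = (if i = k then 1 - r / depth r w i else 1)"
proof -
  note * = coord_vertex[OF assms(1,2)]
  have eq: "(r *\<^sub>R v k + w) \<bullet> g i = r * (if i = k then 1 else 0) - depth r w i"
    unfolding depth_def by (simp add: inner_add_left inner_commute[of _ "g i"] algebra_simps flip: *)
  then show ?thesis
    unfolding dual_vertex_def inner_minus_right inner_scaleR_right eq
    using assms(3) by (auto simp: field_simps)
qed

lemma mem_dual_dilate:
  "y \<in> dual_polytope ((\<lambda>x. r *\<^sub>R x + w) ` body) \<longleftrightarrow> (\<forall>i\<in>I. (r *\<^sub>R v i + w) \<bullet> y \<le> 1)"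
proof
  assume "y \<in> dual_polytope ((\<lambda>x. r *\<^sub>R x + w) ` body)"
  then show "\<forall>i\<in>I. (r *\<^sub>R v i + w) \<bullet> y \<le> 1"
    by (auto simp: dual_polytope_def body_def intro: hull_inc)
next
  assume R: "\<forall>i\<in>I. (r *\<^sub>R v i + w) \<bullet> y \<le> 1"
  have "convex {x. (r *\<^sub>R x + w) \<bullet> y \<le> 1}"
  proof -
    have "{x. (r *\<^sub>R x + w) \<bullet> y \<le> 1} = {x. (r *\<^sub>R y) \<bullet> x \<le> 1 - w \<bullet> y}"
      by (auto simp: inner_add_left inner_commute algebra_simps)
    then show ?thesis by (simp only: convex_halfspace_le)
  qed
  then have "body \<subseteq> {x. (r *\<^sub>R x + w) \<bullet> y \<le> 1}"
    unfolding body_def using R by (intro hull_minimal) auto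
  then show "y \<in> dual_polytope ((\<lambda>x. r *\<^sub>R x + w) ` body)"
    by (auto simp: dual_polytope_def)
qed

lemma dual_vertex_mem:
  assumes "r > 0" "\<And>i. i \<in> I \<Longrightarrow> depth r w i > 0" "i \<in> I"
  shows "dual_vertex r w i \<in> dual_polytope ((\<lambda>x. r *\<^sub>R x + w) ` body)"
  using assms by (auto simp: mem_dual_dilate vertex_dual_vertex less_imp_le)

text \<open>
  These are the barycentric coordinates of \<open>y\<close> in the dual simplex. The \<open>i\<close>-th one is proportional to
  the slack of \<open>y\<close> at the primal vertex \<open>i\<close>; with \<open>r\<close> and the depths positive, all of them are
  nonnegative exactly on the dual polytope.
\<close>

definition dual_coord :: "real \<Rightarrow> real ^ 'n \<Rightarrow> real ^ 'n \<Rightarrow> 'i \<Rightarrow> real"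
  where "dual_coord r w y i = depth r w i / r * (1 - (r *\<^sub>R v i + w) \<bullet> y)"

lemma sum_dual_coord:
  assumes "r > 0"
  shows "(\<Sum>i\<in>I. dual_coord r w y i) = 1"
proof -
  have "r * (\<Sum>i\<in>I. dual_coord r w y i)
      = (\<Sum>i\<in>I. depth r w i) - (\<Sum>i\<in>I. depth r w i *\<^sub>R (r *\<^sub>R v i + w)) \<bullet> y"
    using assms by (simp add: dual_coord_def sum_distrib_left right_diff_distrib sum_subtractf
        inner_sum_left)
  then show ?thesis using assms by (simp add: sum_depth sum_depth_vertex)
qed

lemma dual_coord_expand:
  assumes "r > 0" "\<And>i. i \<in> I \<Longrightarrow> depth r w i > 0"
  shows "(\<Sum>i\<in>I. dual_coord r w y i *\<^sub>R dual_vertex r w i) = y"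
proof -
  have "dual_coord r w y i *\<^sub>R dual_vertex r w i = (v i \<bullet> y) *\<^sub>R g i - ((1 - w \<bullet> y) / r) *\<^sub>R g i"
    if "i \<in> I" for i
  proof -
    have "dual_coord r w y i / depth r w i = (1 - w \<bullet> y) / r - v i \<bullet> y"
      using assms that by (fastforce simp: dual_coord_def inner_add_left field_simps)
    then show ?thesis
      by (simp add: dual_vertex_def divide_inverse scaleR_diff_left)
  qed
  then have "(\<Sum>i\<in>I. dual_coord r w y i *\<^sub>R dual_vertex r w i)
      = (\<Sum>i\<in>I. (v i \<bullet> y) *\<^sub>R g i) - ((1 - w \<bullet> y) / r) *\<^sub>R (\<Sum>i\<in>I. g i)"
    by (simp add: sum_subtractf scaleR_sum_right)
  then show ?thesis by (simp add: expand_adjoint sum_gradient)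
qed

lemma dual_dilate:
  assumes "r > 0" "\<And>i. i \<in> I \<Longrightarrow> depth r w i > 0"
  shows "dual_polytope ((\<lambda>x. r *\<^sub>R x + w) ` body) = convex hull (dual_vertex r w ` I)"
proof (intro subset_antisym)
  show "dual_polytope ((\<lambda>x. r *\<^sub>R x + w) ` body) \<subseteq> convex hull (dual_vertex r w ` I)"
  proof
    fix y assume "y \<in> dual_polytope ((\<lambda>x. r *\<^sub>R x + w) ` body)"
    then have "dual_coord r w y i \<ge> 0" if "i \<in> I" for i
      using assms that by (fastforce simp: mem_dual_dilate dual_coord_def intro!: mult_nonneg_nonneg)
    then have "(\<Sum>i\<in>I. dual_coord r w y i *\<^sub>R dual_vertex r w i) \<in> convex hull (dual_vertex r w ` I)"
      by (intro convex_sum finite_I convex_convex_hull sum_dual_coord assms(1)) (auto intro: hull_inc)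
    then show "y \<in> convex hull (dual_vertex r w ` I)"
      by (simp add: dual_coord_expand assms)
  qed
  have "dual_vertex r w ` I \<subseteq> dual_polytope ((\<lambda>x. r *\<^sub>R x + w) ` body)"
    using assms dual_vertex_mem by blast
  moreover have "convex (dual_polytope P)" for P :: "(real ^ 'n) set"
  proof -
    have "dual_polytope P = (\<Inter>x\<in>P. {y. x \<bullet> y \<le> 1})"
      by (auto simp: dual_polytope_def)
    then show ?thesis by (simp add: convex_INT convex_halfspace_le)
  qed
  ultimately show "convex hull (dual_vertex r w ` I) \<subseteq> dual_polytope ((\<lambda>x. r *\<^sub>R x + w) ` body)"
    by (rule hull_minimal)
qed

text \<open>
  If a dual vertex lies inside a segment of the dual polytope, then the inequalities of all primal
  vertices but one are tight along the segment. All dual barycentric coordinates but one then vanish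
  at both endpoints, which forces both of them to be the dual vertex itself.
\<close>

lemma dual_vertex_extreme:
  assumes "r > 0" "\<And>i. i \<in> I \<Longrightarrow> depth r w i > 0" "i \<in> I"
  shows "dual_vertex r w i extreme_point_of dual_polytope ((\<lambda>x. r *\<^sub>R x + w) ` body)"
    (is "_ extreme_point_of ?D")
  unfolding extreme_point_of_def
proof (intro conjI ballI notI)
  show "dual_vertex r w i \<in> ?D"
    using assms by (rule dual_vertex_mem)
  fix y z assume yz: "y \<in> ?D" "z \<in> ?D" "dual_vertex r w i \<in> open_segment y z"
  then obtain t where t: "0 < t" "t < 1" "dual_vertex r w i = (1 - t) *\<^sub>R y + t *\<^sub>R z" "y \<noteq> z"
    by (auto simp: in_segment)
  have tight: "(r *\<^sub>R v k + w) \<bullet> y = 1 \<and> (r *\<^sub>R v k + w) \<bullet> z = 1" if k: "k \<in> I" "k \<noteq> i" for k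
  proof -
    let ?V = "r *\<^sub>R v k + w"
    have "(1 - t) * (1 - ?V \<bullet> y) + t * (1 - ?V \<bullet> z) = 0"
      using vertex_dual_vertex[of i k r w] assms k t(3)
      by (simp add: inner_add_right algebra_simps)
    moreover have "(1 - t) * (1 - ?V \<bullet> y) \<ge> 0" "t * (1 - ?V \<bullet> z) \<ge> 0"
      using yz k t by (auto simp: mem_dual_dilate)
    ultimately have "(1 - t) * (1 - ?V \<bullet> y) = 0" "t * (1 - ?V \<bullet> z) = 0"
      by linarith+
    then show ?thesis using t by simp
  qed
  have "u = dual_vertex r w i" if "\<And>k. k \<in> I \<Longrightarrow> k \<noteq> i \<Longrightarrow> (r *\<^sub>R v k + w) \<bullet> u = 1" for u
  proof -
    have 0: "dual_coord r w u k = 0" if "k \<in> I - {i}" for k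
      using that \<open>\<And>k. k \<in> I \<Longrightarrow> k \<noteq> i \<Longrightarrow> (r *\<^sub>R v k + w) \<bullet> u = 1\<close> by (simp add: dual_coord_def)
    have "dual_coord r w u i = 1"
      using sum_dual_coord[OF assms(1), of w u] 0 assms(3) by (simp add: sum.remove[OF finite_I])
    then show ?thesis
      using dual_coord_expand[OF assms(1,2), of u] 0 assms(3) by (simp add: sum.remove[OF finite_I])
  qed
  then show False using tight t(4) by metis
qed

text \<open>
  Integrality of the dual vertices already excludes interior lattice points \<open>x \<noteq> 0\<close>: each dual
  vertex pairs with such an \<open>x\<close> to an integer less than 1, hence at most 0. So every
  \<open>g i \<bullet> x\<close> is nonnegative, and since the gradients sum to 0, all of these products vanish.
\<close>

theorem reflexive_dilate_iff:
  assumes "r > 0" "\<And>i. i \<in> I \<Longrightarrow> r *\<^sub>R v i + w \<in> integer_lattice"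
  shows "reflexive ((\<lambda>x. r *\<^sub>R x + w) ` body) \<longleftrightarrow>
    (\<forall>i\<in>I. depth r w i > 0 \<and> g i /\<^sub>R depth r w i \<in> integer_lattice)"
    (is "reflexive ?Q \<longleftrightarrow> _")
proof
  assume refl: "reflexive ?Q"
  then have "0 \<in> interior ?Q" by (auto simp: reflexive_def)
  then have pos: "depth r w i > 0" if "i \<in> I" for i
    using that by (auto simp: interior_dilate assms(1))
  have "dual_vertex r w i \<in> integer_lattice" if "i \<in> I" for i
    using refl dual_vertex_extreme[OF assms(1) pos that]
    by (auto simp: reflexive_def lattice_polytope_def)
  then show "\<forall>i\<in>I. depth r w i > 0 \<and> g i /\<^sub>R depth r w i \<in> integer_lattice"
    using pos integer_lattice_minus unfolding dual_vertex_def by fastforce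
next
  assume R: "\<forall>i\<in>I. depth r w i > 0 \<and> g i /\<^sub>R depth r w i \<in> integer_lattice"
  then have pos: "\<And>i. i \<in> I \<Longrightarrow> depth r w i > 0" by blast
  have int0: "0 \<in> interior ?Q"
    using pos by (simp add: interior_dilate assms(1))
  have Q: "?Q = convex hull ((\<lambda>x. r *\<^sub>R x + w) ` v ` I)"
  proof -
    have "?Q = (+) w ` (*\<^sub>R) r ` body" by (auto simp: image_image add.commute)
    also have "\<dots> = convex hull ((+) w ` (*\<^sub>R) r ` v ` I)"
      by (simp only: body_def convex_hull_scaling convex_hull_translation)
    finally show ?thesis by (simp add: image_image add.commute)
  qed
  have "lattice_polytope ?Q"
    unfolding Q using assms(2) finite_I by (intro lattice_polytope_convex_hull) auto
  moreover have "aff_dim ?Q = int CARD('n)"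
    using int0 aff_dim_nonempty_interior[of ?Q] by auto
  moreover have "x = 0" if x: "x \<in> interior ?Q" "x \<in> integer_lattice" for x
  proof -
    let ?m = "\<lambda>i. (g i /\<^sub>R depth r w i) \<bullet> x"
    have nonneg: "?m i \<ge> 0" if i: "i \<in> I" for i
    proof -
      have "?m i \<in> \<int>" using R i x by (intro inner_integer_lattice) auto
      moreover have "depth r w i + g i \<bullet> x > 0"
        using x i by (simp add: interior_dilate assms(1))
      then have "?m i > -1" using pos[OF i] by (simp add: field_simps)
      ultimately show ?thesis by (auto elim!: Ints_cases)
    qed
    have "g i \<bullet> x \<ge> 0" if "i \<in> I" for i
      using nonneg[OF that] pos[OF that] by (simp add: zero_le_mult_iff)
    then have "\<forall>i\<in>I. g i \<bullet> x = 0"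
      using sum_gradient_inner[of x] finite_I by (simp add: sum_nonneg_eq_0_iff)
    then show "x = 0" using expand_linear[of x] by simp
  qed
  then have "interior ?Q \<inter> integer_lattice = {0}"
    using int0 integer_lattice_0 by blast
  moreover have "lattice_polytope (dual_polytope ?Q)"
  proof -
    have "dual_vertex r w ` I \<subseteq> integer_lattice"
      using R by (auto simp: dual_vertex_def intro: integer_lattice_minus)
    then show ?thesis
      using finite_I by (simp add: dual_dilate assms(1) pos lattice_polytope_convex_hull)
  qed
  ultimately show "reflexive ?Q"
    by (simp add: reflexive_def full_dim_lattice_polytope_def)
qed

corollary gorenstein_iff:
  assumes "\<And>i. i \<in> I \<Longrightarrow> v i \<in> integer_lattice" "r > 0"
  shows "gorenstein_of_index r body \<longleftrightarrow>
    (\<exists>p\<in>integer_lattice. \<forall>i\<in>I. real r * c i + g i \<bullet> p > 0 \<and>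
        g i /\<^sub>R (real r * c i + g i \<bullet> p) \<in> integer_lattice)"
    (is "_ \<longleftrightarrow> (\<exists>p\<in>_. ?good p)")
proof -
  have refl: "reflexive ((\<lambda>x. real r *\<^sub>R x + w) ` body) \<longleftrightarrow> ?good (- w)"
    if "w \<in> integer_lattice" for w
    using reflexive_dilate_iff[of "real r" w] assms that
    by (simp add: depth_def integer_lattice_add integer_lattice_scaleR)
  have "full_dim_lattice_polytope body" if good: "?good p" for p
  proof -
    have "p /\<^sub>R real r \<in> interior body"
      using good interior_dilate[of 1 0] assms(2) by (simp add: depth_def field_simps)
    then show ?thesis
      using aff_dim_nonempty_interior[of body] lattice_polytope_convex_hull[of "v ` I"]
        assms(1) finite_I
      by (auto simp: full_dim_lattice_polytope_def body_def)
  qed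
  then show ?thesis
    unfolding gorenstein_of_index_def using refl assms(2)
    by (metis (no_types, lifting) add.inverse_inverse integer_lattice_minus)
qed

end


section \<open>The barycentric coordinates of \<open>\<Delta>(A)\<close>\<close>

text \<open>
  Expanding \<open>x\<close> in \<open>v 1, \<dots>, v d\<close> starts with the last coordinate \<open>x \<bullet> e d / a d\<close>, because only
  \<open>v d\<close> has a component along \<open>e d\<close>, and then corrects the remaining ones by the components of
  \<open>v d\<close>. The gradient at \<open>0\<close> makes the coordinates sum to a constant.
\<close>

definition Delta_gradient :: "(nat \<Rightarrow> real ^ 'n) \<Rightarrow> (nat \<Rightarrow> int) \<Rightarrow> nat \<Rightarrow> real ^ 'n"
  where "Delta_gradient e a i =
    (let d = CARD('n);
         f = \<lambda>j. if j < d then e j - (1 - real_of_int (a j) / real_of_int (a d)) *\<^sub>R e d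
                 else (1 / real_of_int (a d)) *\<^sub>R e d
     in if i = 0 then - (\<Sum>j=1..d. f j) else f i)"

locale Delta_simplex =
  fixes e :: "nat \<Rightarrow> real ^ 'n" and a :: "nat \<Rightarrow> int" and d :: nat
  assumes d: "d = CARD('n)" and enum: "unit_vector_enum e" and pos: "a d > 0"
begin

lemma d_pos: "d > 0"
  by (simp add: d)

lemma inner_unit: "i \<in> {1..d} \<Longrightarrow> j \<in> {1..d} \<Longrightarrow> e i \<bullet> e j = (if i = j then 1 else 0)"
  using enum unfolding unit_vector_enum_def bij_betw_def inj_on_def d
  by (metis image_eqI inner_Basis)

lemma unit_expand: "(\<Sum>j=1..d. (x \<bullet> e j) *\<^sub>R e j) = x"
  using sum.reindex_bij_betw[OF enum[unfolded unit_vector_enum_def], of "\<lambda>b. (x \<bullet> b) *\<^sub>R b"]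
  by (simp add: d euclidean_representation)

lemma integer_lattice_iff_unit: "x \<in> integer_lattice \<longleftrightarrow> (\<forall>j\<in>{1..d}. x \<bullet> e j \<in> \<int>)"
  using enum unfolding unit_vector_enum_def bij_betw_def d integer_lattice_iff_Basis
  by (metis (no_types, lifting) image_iff)

lemma unit_in_lattice: "j \<in> {1..d} \<Longrightarrow> e j \<in> integer_lattice"
  by (auto simp: integer_lattice_iff_unit inner_unit)

lemma atLeast1AtMost_split: "{1..d} = insert d {1..<d}"
  using d_pos by auto

lemma atLeast0AtMost_split: "{0..d} = insert 0 {1..d}"
  by auto

lemma Delta_vertex_lattice: "Delta_vertex e a i \<in> integer_lattice"
  using d_pos unfolding Delta_vertex_def d[symmetric]
  by (auto intro!: integer_lattice_0 integer_lattice_add integer_lattice_sum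
      integer_lattice_scaleR unit_in_lattice)

lemma Delta_vertex_0: "Delta_vertex e a 0 = 0"
  by (simp add: Delta_vertex_def)

lemma gradient_inner:
  "1 \<le> j \<Longrightarrow> j < d \<Longrightarrow> Delta_gradient e a j \<bullet> x = x \<bullet> e j - (1 - a j / a d) * (x \<bullet> e d)"
  "Delta_gradient e a d \<bullet> x = (x \<bullet> e d) / a d"
  using d_pos by (auto simp: Delta_gradient_def Let_def d[symmetric] inner_diff_left inner_commute[of _ x] inner_diff_right)

lemma gradient_0: "Delta_gradient e a 0 = - (\<Sum>j=1..d. Delta_gradient e a j)"
  unfolding Delta_gradient_def Let_def d[symmetric] by (simp cong: sum.cong_simp)

lemma sum_Delta_gradient: "(\<Sum>j=0..d. Delta_gradient e a j) = 0"
  by (simp only: atLeast0AtMost_split) (simp add: gradient_0)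

lemma vertex_inner:
  assumes "1 \<le> j" "j < d"
  shows "Delta_vertex e a k \<bullet> e j =
    (if k = 0 then 0 else if k < d then (if k = j then 1 else 0) else a d - a j)"
proof -
  have "(\<Sum>i=1..<d. real_of_int (a d - a i) *\<^sub>R e i) \<bullet> e j = (\<Sum>i=1..<d. if i = j then a d - a j else 0)"
    unfolding inner_sum_left of_int_sum using assms by (intro sum.cong) (auto simp: inner_unit)
  then show ?thesis
    using assms by (auto simp: Delta_vertex_def d[symmetric] inner_add_left inner_unit)
qed

lemma vertex_inner_top: "Delta_vertex e a k \<bullet> e d = (if k < d then 0 else a d)"
proof -
  have "(\<Sum>i=1..<d. real_of_int (a d - a i) *\<^sub>R e i) \<bullet> e d = 0"
    unfolding inner_sum_left by (intro sum.neutral) (auto simp: inner_unit)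
  then show ?thesis
    using d_pos by (auto simp: Delta_vertex_def d[symmetric] inner_add_left inner_unit)
qed

lemma Delta_expand: "(\<Sum>j=1..d. (Delta_gradient e a j \<bullet> x) *\<^sub>R Delta_vertex e a j) = x"
proof -
  have "(\<Sum>j=1..<d. (Delta_gradient e a j \<bullet> x) *\<^sub>R Delta_vertex e a j)
    = (\<Sum>j=1..<d. (x \<bullet> e j) *\<^sub>R e j - (((x \<bullet> e d) / a d) * (a d - a j)) *\<^sub>R e j)"
  proof (intro sum.cong refl)
    fix j assume j: "j \<in> {1..<d}"
    have "Delta_gradient e a j \<bullet> x = x \<bullet> e j - ((x \<bullet> e d) / a d) * (a d - a j)"
      using j pos by (simp add: gradient_inner field_simps)
    then show "(Delta_gradient e a j \<bullet> x) *\<^sub>R Delta_vertex e a j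
        = (x \<bullet> e j) *\<^sub>R e j - (((x \<bullet> e d) / a d) * (a d - a j)) *\<^sub>R e j"
      using j by (simp add: Delta_vertex_def d[symmetric] scaleR_diff_left)
  qed
  moreover have "(Delta_gradient e a d \<bullet> x) *\<^sub>R Delta_vertex e a d
    = (\<Sum>j=1..<d. (((x \<bullet> e d) / a d) * (a d - a j)) *\<^sub>R e j) + (x \<bullet> e d) *\<^sub>R e d"
    using d_pos pos
    by (simp add: Delta_vertex_def d[symmetric] gradient_inner scaleR_add_right scaleR_sum_right)
  ultimately show ?thesis
    using unit_expand[of x] unfolding atLeast1AtMost_split by (simp add: sum_subtractf)
qed

lemma Delta_barycentric:
  "barycentric_simplex {0..d} (Delta_vertex e a) (Delta_gradient e a) (\<lambda>i. if i = 0 then 1 else 0)"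
proof
  let ?c = "\<lambda>i::nat. if i = 0 then 1 else 0 :: real"
  show sum: "(\<Sum>i=0..d. ?c i + Delta_gradient e a i \<bullet> x) = 1" for x
    using sum_Delta_gradient by (simp add: sum.distrib flip: inner_sum_left)
  show "(\<Sum>i=0..d. (?c i + Delta_gradient e a i \<bullet> x) *\<^sub>R Delta_vertex e a i) = x" for x
    unfolding atLeast0AtMost_split
    using Delta_expand[of x] by (simp add: Delta_vertex_0 cong: sum.cong_simp)
  \<comment> \<open>For \<open>i = 0\<close> the claim follows from the others, since the coordinates of a vertex sum to 1.\<close>
  have kron: "?c i + Delta_gradient e a i \<bullet> Delta_vertex e a k = (if i = k then 1 else 0)"
    if "i \<in> {1..d}" "k \<in> {0..d}" for i k
  proof (cases "i = d")
    case True
    then show ?thesis using that pos d_pos by (auto simp: gradient_inner vertex_inner_top)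
  next
    case False
    then show ?thesis using that pos by (auto simp: gradient_inner vertex_inner vertex_inner_top field_simps)
  qed
  fix i k assume ik: "i \<in> {0..d}" "k \<in> {0..d}"
  show "?c i + Delta_gradient e a i \<bullet> Delta_vertex e a k = (if i = k then 1 else 0)"
  proof (cases "i = 0")
    case True
    have "(\<Sum>i=1..d. ?c i + Delta_gradient e a i \<bullet> Delta_vertex e a k) = (\<Sum>i=1..d. if i = k then 1 else 0)"
      using ik by (intro sum.cong kron) auto
    then show ?thesis
      using sum[of "Delta_vertex e a k"] ik True
      by (simp only: atLeast0AtMost_split) (auto split: if_splits)
  qed (use kron ik in auto)
qed simp

sublocale barycentric_simplex
  "{0..d}" "Delta_vertex e a" "Delta_gradient e a" "\<lambda>i. if i = 0 then 1 else 0"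
  by (rule Delta_barycentric)

lemma gorenstein_Delta_iff:
  assumes "r > 0"
  shows "gorenstein_of_index r (Delta e a) \<longleftrightarrow>
    (\<exists>p\<in>integer_lattice. \<forall>i\<in>{0..d}. real r * (if i = 0 then 1 else 0) + Delta_gradient e a i \<bullet> p > 0 \<and>
        Delta_gradient e a i /\<^sub>R (real r * (if i = 0 then 1 else 0) + Delta_gradient e a i \<bullet> p) \<in> integer_lattice)"
  using gorenstein_iff[OF Delta_vertex_lattice assms]
  by (simp add: Delta_def body_def d[symmetric])

text \<open>
  Modulo the integer lattice, the gradients with index below \<open>d\<close> are multiples of \<open>e d / a d\<close> with
  coefficients \<open>a i\<close>. For \<open>i = 0\<close>, minus the sum of the other gradients has coefficient
  \<open>- (a 1 + \<dots> + a (d - 1) + 1)\<close>, which is congruent to \<open>a 0\<close> modulo \<open>a d\<close> by the hypothesis.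
\<close>

lemma gradient_mod_lattice:
  assumes "a d dvd (\<Sum>i<d. a i) + 1" "i < d"
  shows "Delta_gradient e a i - (a i / a d) *\<^sub>R e d \<in> integer_lattice"
proof (cases "i = 0")
  case False
  then have "Delta_gradient e a i - (a i / a d) *\<^sub>R e d = e i - e d"
    using assms(2) by (simp add: Delta_gradient_def d[symmetric] algebra_simps)
  then show ?thesis
    using False assms(2) d_pos by (auto intro!: integer_lattice_diff unit_in_lattice)
next
  case True
  have split: "{..<d} = insert 0 {1..<d}" using d_pos by auto
  obtain k where k: "(\<Sum>i<d. a i) + 1 = a d * k" using assms(1) by blast
  have "Delta_gradient e a 0 = - (\<Sum>j=1..<d. e j - e d + (a j / a d) *\<^sub>R e d) - (1 / a d) *\<^sub>R e d"
    unfolding gradient_0 atLeast1AtMost_split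
    using d_pos by (simp add: Delta_gradient_def d[symmetric] algebra_simps)
  also have "\<dots> = - (\<Sum>j=1..<d. e j - e d) - (((\<Sum>j=1..<d. a j) + 1) / a d) *\<^sub>R e d"
    unfolding sum.distrib
    by (simp add: add_divide_distrib sum_divide_distrib scaleR_sum_left scaleR_add_left)
  also have "((\<Sum>j=1..<d. a j) + 1) / a d = k - a 0 / real_of_int (a d)"
  proof -
    have "a 0 + ((\<Sum>j=1..<d. a j) + 1) = a d * k"
      using k by (simp add: split)
    then have "real_of_int (a 0) + real_of_int ((\<Sum>j=1..<d. a j) + 1) = real_of_int (a d) * k"
      by (metis of_int_add of_int_mult)
    then show ?thesis using pos by (simp add: field_simps)
  qed
  finally have "Delta_gradient e a 0 - (a 0 / a d) *\<^sub>R e d = - (\<Sum>j=1..<d. e j - e d) - real_of_int k *\<^sub>R e d"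
    by (simp add: algebra_simps)
  then show ?thesis
    using True d_pos
    by (auto intro!: integer_lattice_diff integer_lattice_minus integer_lattice_sum
        integer_lattice_scaleR unit_in_lattice)
qed

end

section \<open>The Gorenstein condition for \<open>\<Delta>(A)\<close>\<close>

lemma Ints_pos_ge_1: "x \<in> \<int> \<Longrightarrow> x > 0 \<Longrightarrow> x \<ge> 1" for x :: real
  by (auto elim!: Ints_cases simp: int_one_le_iff_zero_less)

lemma Ints_unit_fraction:
  fixes x :: real
  assumes "x \<in> \<int>" "1 / x \<in> \<int>" "x > 0"
  shows "x = 1"
proof -
  have "x \<ge> 1" "1 / x \<ge> 1" 
    using assms Ints_pos_ge_1[of x] Ints_pos_ge_1[of "1 / x"] by simp_all
  then show ?thesis using assms(3) by (simp add: field_simps)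
qed

theorem theorem2p3:
  fixes e :: "nat \<Rightarrow> real ^ 'n" and a :: "nat \<Rightarrow> int" and d r :: nat
  assumes "d = CARD('n)"
    and "unit_vector_enum e"
    and "\<And>i. 1 \<le> i \<Longrightarrow> i < d \<Longrightarrow> 1 \<le> a i \<and> a i \<le> a d"
    and "1 \<le> a 0" and "a 0 \<le> a d"
    and "a d dvd (\<Sum>i<d. a i) + 1"
    and "r > 0"
    and "\<And>i. i < d \<Longrightarrow> 1 \<le> a i \<and> a i < a d"
  shows "gorenstein_of_index r (Delta e a) \<longleftrightarrow>
    (\<forall>i<d. a i dvd a d) \<and> int r * a d = (\<Sum>i<d. a i) + 1"
proof -
  have pos: "a d > 0" using assms(4,5) by simp
  interpret Delta_simplex e a d
    by unfold_locales (fact assms(1,2) pos)+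
  let ?g = "Delta_gradient e a" and ?v = "Delta_vertex e a"
  let ?m = "\<lambda>p i. real r * (if i = 0 then 1 else 0) + ?g i \<bullet> p"
  have dpos: "d > 0" by (simp add: assms(1))
  have sum_m: "(\<Sum>i<d. ?m p i) + ?m p d = r" for p
    using sum_depth[of r "- p"] by (simp add: depth_def atLeast0AtMost lessThan_Suc_atMost[symmetric])
  have sum_iff: "int r * a d = (\<Sum>i<d. a i) + 1 \<longleftrightarrow> (\<Sum>i<d. a i / real_of_int (a d)) + 1 / a d = r"
  proof -
    have "int r * a d = (\<Sum>i<d. a i) + 1 \<longleftrightarrow> real_of_int (int r * a d) = real_of_int ((\<Sum>i<d. a i) + 1)"
      by (simp only: of_int_eq_iff)
    also have "\<dots> \<longleftrightarrow> ((\<Sum>i<d. a i) + 1) / real_of_int (a d) = r"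
      using pos by (auto simp: field_simps)
    finally show ?thesis by (simp add: add_divide_distrib sum_divide_distrib)
  qed
  show ?thesis
  proof
    assume "gorenstein_of_index r (Delta e a)"
    then obtain p where p: "p \<in> integer_lattice"
      and m_pos: "\<And>i. i \<le> d \<Longrightarrow> ?m p i > 0"
      and m_int: "\<And>i. i \<le> d \<Longrightarrow> ?g i /\<^sub>R ?m p i \<in> integer_lattice"
      unfolding gorenstein_Delta_iff[OF assms(7)] by auto
    have inv_m: "1 / ?m p i \<in> \<int>" if i: "i \<le> d" for i
    proof -
      obtain k where k: "k \<in> {0..d}" "k \<noteq> i" using another_vertex[of i] i by auto
      have "(?g i /\<^sub>R ?m p i) \<bullet> (?v i - ?v k) = 1 / ?m p i"
        using gradient_edge[of i k] i k by (simp add: divide_inverse)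
      moreover have "(?g i /\<^sub>R ?m p i) \<bullet> (?v i - ?v k) \<in> \<int>"
        using m_int[OF i] by (intro inner_integer_lattice integer_lattice_diff Delta_vertex_lattice)
      ultimately show ?thesis by simp
    qed
    have md: "?m p d = (p \<bullet> e d) / a d"
      using dpos by (simp add: gradient_inner)
    have top: "p \<bullet> e d = 1"
    proof (rule Ints_unit_fraction)
      show "p \<bullet> e d \<in> \<int>"
        using p dpos by (intro inner_integer_lattice unit_in_lattice) auto
      show "p \<bullet> e d > 0"
        using m_pos[of d] md pos by (simp add: zero_less_divide_iff)
      have "(?g d /\<^sub>R ?m p d) \<bullet> e d \<in> \<int>"
        using m_int[of d] dpos by (intro inner_integer_lattice unit_in_lattice) auto
      moreover have "(?g d /\<^sub>R ?m p d) \<bullet> e d = 1 / (p \<bullet> e d)"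
        unfolding md using pos dpos
        by (simp add: gradient_inner inner_unit field_simps)
      ultimately show "1 / (p \<bullet> e d) \<in> \<int>" by simp
    qed
    \<comment> \<open>The two sides agree modulo 1, and they lie in \<open>(0, 1]\<close> and \<open>(0, 1)\<close> respectively.\<close>
    have m_eq: "?m p i = a i / a d" if i: "i < d" for i
    proof -
      have "(?g i - (a i / a d) *\<^sub>R e d) \<bullet> p \<in> \<int>"
        using p i assms(6) by (intro inner_integer_lattice gradient_mod_lattice)
      then have "real r * (if i = 0 then 1 else 0) + (?g i - (a i / a d) *\<^sub>R e d) \<bullet> p \<in> \<int>"
        by (intro Ints_add Ints_mult) auto
      moreover have "real r * (if i = 0 then 1 else 0) + (?g i - (a i / a d) *\<^sub>R e d) \<bullet> p = ?m p i - a i / a d"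
        using top by (simp add: inner_diff_left inner_commute[of "e d"])
      ultimately have diff: "?m p i - a i / a d \<in> \<int>" by simp
      have "1 / ?m p i \<ge> 1"
        using inv_m[of i] m_pos[of i] i by (intro Ints_pos_ge_1) simp_all
      then have "?m p i \<le> 1" "?m p i > 0"
        using m_pos[of i] i by (simp_all add: field_simps)
      moreover have "0 < a i / real_of_int (a d)" "a i / real_of_int (a d) < 1"
        using assms(8)[OF i] pos by simp_all
      ultimately have "\<bar>?m p i - a i / a d\<bar> < 1" by linarith
      then show ?thesis using diff Ints_nonzero_abs_less1 by fastforce
    qed
    have "a i dvd a d" if i: "i < d" for i
    proof -
      have "real_of_int (a d) / real_of_int (a i) \<in> \<int>"
        using inv_m[of i] i m_eq[OF i] by simp
      then show ?thesis
        using assms(8)[OF i] by (simp add: of_int_div_of_int_in_Ints_iff)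
    qed
    moreover have "(\<Sum>i<d. a i / real_of_int (a d)) + 1 / a d = r"
      using sum_m[of p] m_eq md top by simp
    ultimately show "(\<forall>i<d. a i dvd a d) \<and> int r * a d = (\<Sum>i<d. a i) + 1"
      using sum_iff by blast
  next
    assume R: "(\<forall>i<d. a i dvd a d) \<and> int r * a d = (\<Sum>i<d. a i) + 1"
    \<comment> \<open>The lattice point at lattice distance 1 from every facet with index \<open>i > 0\<close>; the value of
      \<open>r\<close> makes its lattice distance from the remaining facet equal to 1 too.\<close>
    define p where "p = (\<Sum>j=1..d. e j)"
    have p: "p \<in> integer_lattice"
      unfolding p_def by (intro integer_lattice_sum unit_in_lattice)
    have p_inner: "p \<bullet> e j = 1" if "j \<in> {1..d}" for j
    proof -
      have "p \<bullet> e j = (\<Sum>i=1..d. if i = j then 1 else 0)"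
        unfolding p_def inner_sum_left using that by (intro sum.cong) (auto simp: inner_unit)
      then show ?thesis using that by simp
    qed
    have md: "?m p d = 1 / a d"
      using dpos by (simp add: gradient_inner p_inner)
    have mj: "?m p j = a j / a d" if "j \<in> {1..<d}" for j
      using that by (simp add: gradient_inner p_inner)
    \<comment> \<open>The case \<open>i = 0\<close> is the one where the formula for \<open>r\<close>, the sum of all coordinates, enters.\<close>
    have m_eq: "?m p i = a i / a d" if "i < d" for i
    proof (cases "i = 0")
      case True
      have "{..<d} = insert 0 {1..<d}" using dpos by auto
      then have split: "(\<Sum>i<d. f i) = f 0 + (\<Sum>i=1..<d. f i)" for f :: "nat \<Rightarrow> real"
        by simp
      have "(\<Sum>i<d. ?m p i) = (\<Sum>i<d. a i / real_of_int (a d))"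
        using sum_m[of p] md R sum_iff by linarith
      moreover have "(\<Sum>i=1..<d. ?m p i) = (\<Sum>i=1..<d. a i / real_of_int (a d))"
        by (intro sum.cong mj) auto
      ultimately show ?thesis
        unfolding split True by linarith
    qed (use that mj in auto)
    have "?m p i > 0 \<and> ?g i /\<^sub>R ?m p i \<in> integer_lattice" if i: "i \<le> d" for i
    proof (cases "i = d")
      case True
      have "?g d /\<^sub>R ?m p d = e d"
        unfolding md using pos dpos by (simp add: Delta_gradient_def assms(1)[symmetric])
      then show ?thesis
        using True md pos dpos by (auto simp del: mult_eq_0_iff intro!: unit_in_lattice)
    next
      case False
      then have i: "i < d" using i by simp
      have ai: "a i > 0" using assms(8)[OF i] by simp
      let ?h = "?g i - (a i / a d) *\<^sub>R e d"
      have "?g i /\<^sub>R (a i / a d) = (a d / a i) *\<^sub>R ?h + e d"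
        using ai pos by (simp add: scaleR_diff_right)
      moreover have "real_of_int (a d) / real_of_int (a i) \<in> \<int>"
        using R i by (simp add: of_int_div_of_int_in_Ints_iff)
      ultimately show ?thesis
        unfolding m_eq[OF i] using ai pos i dpos assms(6)
        by (auto intro!: integer_lattice_add integer_lattice_scaleR unit_in_lattice gradient_mod_lattice)
    qed
    then show "gorenstein_of_index r (Delta e a)"
      unfolding gorenstein_Delta_iff[OF assms(7)] using p by (intro bexI[of _ p]) auto
  qed
qed

end
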